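(* Let $(\Omega,\mu)$ be a complete $\sigma$-finite measure space and let $\Phi_1,\Phi_2,\Phi_3$ be Young functions. Suppose there exists a positive constant $C$ such that, for all $u\in(0,\infty)$, $$\Phi_2^{-1}(u)\le C\,\Phi_1^{-1}(u)\,\Phi_3^{-1}(u).$$ Then $$\mathrm{PWM}(\mathrm{w}L^{\Phi_1}(\Omega),\mathrm{w}L^{\Phi_2}(\Omega))\subset \mathrm{w}L^{\Phi_3}(\Omega),$$ and, for all $g\in\mathrm{PWM}(\mathrm{w}L^{\Phi_1}(\Omega),\mathrm{w}L^{\Phi_2}(\Omega))$, $$\|g\|_{\mathrm{w}L^{\Phi_3}(\Omega)}\le C\,\|g\|_{\mathrm{PWM}(\mathrm{w}L^{\Phi_1}(\Omega),\mathrm{w}L^{\Phi_2}(\Omega))}.$$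
   Context: $L^0(\Omega)$ is the set of all measurable functions from $\Omega$ to $\mathbb{R}$ or $\mathbb{C}$ (functions equal a.e. are identified). The convention $0\cdot\infty=0$ is used. Young functions. "Increasing" means nondecreasing. For an increasing function $\Phi:[0,\infty]\to[0,\infty]$ let $a(\Phi)=\sup\{t\ge0:\Phi(t)=0\}$ and $b(\Phi)=\inf\{t\ge0:\Phi(t)=\infty\}$, with $\sup\emptyset=0$, $\inf\emptyset=\infty$. $\Phi$ is a Young function if: $0\le a(\Phi)<\infty$ and $0<b(\Phi)\le\infty$; $\lim_{t\to+0}\Phi(t)=\Phi(0)=0$; $\Phi$ is convex on $[0,b(\Phi))$; if $b(\Phi)=\infty$ then $\lim_{t\to\infty}\Phi(t)=\Phi(\infty)=\infty$; if $b(\Phi)<\infty$ then $\lim_{t\to b(\Phi)-0}\Phi(t)=\Phi(b(\Phi))\ (\le\infty)$. Generalized inverse: $\Phi^{-1}(u)=\inf\{t\ge0:\Phi(t)>u\}$ for $u\in[0,\infty)$, and $\Phi^{-1}(\infty)=\infty$. Weak Orlicz space: for $f\in L^0(\Omega)$ and $t\ge 0$ let $\mu(f,t)=\mu(\{x\in\Omega:|f(x)|>t\})$. Then $$\mathrm{w}L^{\Phi}(\Omega)=\Big\{f\in L^0(\Omega):\sup_{t\in(0,\infty)}\Phi(t)\,\mu(\epsilon f,t)<\infty\text{ for some }\epsilon>0\Big\},$$ $$\|f\|_{\mathrm{w}L^{\Phi}(\Omega)}=\inf\Big\{\lambda>0:\sup_{t\in(0,\infty)}\Phi(t)\,\mu(f/\lambda,t)\le1\Big\},$$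 which is a quasi-norm; $\mathrm{w}L^{\Phi}(\Omega)$ is a complete quasi-normed space. Pointwise multipliers: for subspaces $E_1,E_2\subset L^0(\Omega)$, $\mathrm{PWM}(E_1,E_2)$ is the set of all $g\in L^0(\Omega)$ such that $fg\in E_2$ for every $f\in E_1$. When $E_1,E_2$ are quasi-normed, $\|g\|_{\mathrm{PWM}(E_1,E_2)}$ denotes the operator norm of $f\mapsto fg$, i.e. the infimum of the $K\ge0$ such that $\|fg\|_{E_2}\le K\|f\|_{E_1}$ for all $f\in E_1$. It is a known fact that for complete quasi-normed spaces $E_1,E_2\subset L^0(\Omega)$ with the lattice property ($f\in E$, $h\in L^0(\Omega)$, $|h|\le|f|$ a.e. imply $h\in E$ and $\|h\|_E\le\|f\|_E$), in particular for weak Orlicz spaces, every $g\in\mathrm{PWM}(E_1,E_2)$ defines a bounded operator, so this operator norm is finite. *)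

theory Defs
  imports "HOL-Analysis.Analysis"
begin

text \<open>
  The interval \<open>[0, \<infinity>]\<close> is the type \<^typ>\<open>ennreal\<close>, in which \<open>0 * \<infinity> = 0\<close>, \<open>Sup {} = 0\<close> and
  \<open>Inf {} = \<infinity>\<close>.
\<close>

definition young_a :: "(ennreal \<Rightarrow> ennreal) \<Rightarrow> ennreal" where
  "young_a \<Phi> = Sup {t. \<Phi> t = 0}"

definition young_b :: "(ennreal \<Rightarrow> ennreal) \<Rightarrow> ennreal" where
  "young_b \<Phi> = Inf {t. \<Phi> t = \<infinity>}"

text \<open>
  In the convexity clause, \<^const>\<open>enn2real\<close> loses nothing: \<open>\<Phi>\<close> is finite on \<open>[0, young_b \<Phi>)\<close>.
  The limit as \<open>t\<close> tends to \<open>\<infinity>\<close> is \<^term>\<open>at_left (\<infinity>::ennreal)\<close>.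
\<close>

definition young_function :: "(ennreal \<Rightarrow> ennreal) \<Rightarrow> bool" where
  "young_function \<Phi> \<longleftrightarrow>
     mono \<Phi> \<and>
     young_a \<Phi> < \<infinity> \<and> 0 < young_b \<Phi> \<and>
     \<Phi> 0 = 0 \<and> (\<Phi> \<longlongrightarrow> 0) (at_right 0) \<and>
     convex_on {t. 0 \<le> t \<and> ennreal t < young_b \<Phi>} (\<lambda>t. enn2real (\<Phi> (ennreal t))) \<and>
     (young_b \<Phi> = \<infinity> \<longrightarrow> \<Phi> \<infinity> = \<infinity> \<and> (\<Phi> \<longlongrightarrow> \<infinity>) (at_left \<infinity>)) \<and>
     (young_b \<Phi> < \<infinity> \<longrightarrow> (\<Phi> \<longlongrightarrow> \<Phi> (young_b \<Phi>)) (at_left (young_b \<Phi>)))"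

definition young_inv :: "(ennreal \<Rightarrow> ennreal) \<Rightarrow> ennreal \<Rightarrow> ennreal" where
  "young_inv \<Phi> u = (if u = \<infinity> then \<infinity> else Inf {t. \<Phi> t > u})"

text \<open>
  The scalar type \<open>'k\<close> stands for the reals or the complex numbers, both of which are instances of
  the classes below. The elements of \<open>L\<^sup>0\<close> are represented by measurable functions; all notions
  below are invariant under changing the functions on a null set.
\<close>

definition distribution_fun :: "'a measure \<Rightarrow> ('a \<Rightarrow> 'k::real_normed_field) \<Rightarrow> real \<Rightarrow> ennreal" where
  "distribution_fun M f t = emeasure M {x \<in> space M. norm (f x) > t}"

definition weak_modular ::
  "'a measure \<Rightarrow> (ennreal \<Rightarrow> ennreal) \<Rightarrow> ('a \<Rightarrow> 'k::real_normed_field) \<Rightarrow> ennreal" where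
  "weak_modular M \<Phi> f = (SUP t\<in>{0<..}. \<Phi> (ennreal t) * distribution_fun M f t)"

definition weak_orlicz ::
  "'a measure \<Rightarrow> (ennreal \<Rightarrow> ennreal) \<Rightarrow>
    ('a \<Rightarrow> 'k::{real_normed_field, second_countable_topology}) set" where
  "weak_orlicz M \<Phi> =
     {f \<in> borel_measurable M. \<exists>\<epsilon>::real. \<epsilon> > 0 \<and> weak_modular M \<Phi> (\<lambda>x. \<epsilon> *\<^sub>R f x) < \<infinity>}"

definition weak_orlicz_norm ::
  "'a measure \<Rightarrow> (ennreal \<Rightarrow> ennreal) \<Rightarrow> ('a \<Rightarrow> 'k::real_normed_field) \<Rightarrow> ennreal" where
  "weak_orlicz_norm M \<Phi> f =
     Inf {ennreal l | l::real. l > 0 \<and> weak_modular M \<Phi> (\<lambda>x. f x /\<^sub>R l) \<le> 1}"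

definition PWM ::
  "'a measure \<Rightarrow> ('a \<Rightarrow> 'k::{real_normed_field, second_countable_topology}) set \<Rightarrow>
    ('a \<Rightarrow> 'k) set \<Rightarrow> ('a \<Rightarrow> 'k) set" where
  "PWM M E1 E2 = {g \<in> borel_measurable M. \<forall>f\<in>E1. (\<lambda>x. f x * g x) \<in> E2}"

text \<open>
  \<open>N1\<close> is the quasi-norm of the domain \<open>E1\<close> and \<open>N2\<close> that of the target space.
\<close>

definition PWM_norm ::
  "('a \<Rightarrow> 'k::real_normed_field) set \<Rightarrow> (('a \<Rightarrow> 'k) \<Rightarrow> ennreal) \<Rightarrow>
    (('a \<Rightarrow> 'k) \<Rightarrow> ennreal) \<Rightarrow> ('a \<Rightarrow> 'k) \<Rightarrow> ennreal" where
  "PWM_norm E1 N1 N2 g =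
     Inf {ennreal K | K::real. K \<ge> 0 \<and> (\<forall>f\<in>E1. N2 (\<lambda>x. f x * g x) \<le> ennreal K * N1 f)}"

end

theory Submission imports Defs begin

text \<open>
  If \<open>K\<close> bounds the multiplication by \<open>g\<close>, apply the bound to the indicator function of a set \<open>E\<close>
  of finite positive measure on which \<open>\<bar>g\<bar> > t\<close>. As the indicator has quasi-norm
  \<open>1 / \<Phi>\<^sup>-\<^sup>1(1 / \<mu>(E))\<close>, this gives \<open>t \<Phi>\<^sub>1\<^sup>-\<^sup>1(u) \<le> K \<Phi>\<^sub>2\<^sup>-\<^sup>1(u)\<close> with \<open>u = 1 / \<mu>(E)\<close>, hence
  \<open>t \<le> C K \<Phi>\<^sub>3\<^sup>-\<^sup>1(u)\<close> by the hypothesis. Exhausting the superlevel sets of \<open>g\<close> by such \<open>E\<close> bounds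
  the weak modular of \<open>g / (C K)\<close> by 1.
\<close>

section \<open>Young functions and their generalized inverses\<close>

text \<open>A point strictly below an infimum lies outside the set. At the infimum itself left
  continuity of \<open>\<Phi>\<close> would enter, so the arguments below arrange strict
  inequalities.\<close>

lemma young_le_of_less_inv:
  assumes "t < young_inv \<Phi> u"
  shows "\<Phi> t \<le> u"
proof (rule ccontr)
  assume "\<not> \<Phi> t \<le> u"
  then have "young_inv \<Phi> u \<le> t"
    unfolding young_inv_def by (cases "u = \<infinity>") (auto intro: Inf_lower)
  with assms show False by simp
qed

lemma le_young_inv:
  assumes "mono \<Phi>" "\<Phi> t \<le> u"
  shows "t \<le> young_inv \<Phi> u"
proof (cases "u = \<infinity>")
  case False
  have "t \<le> x" if "u < \<Phi> x" for x
  proof (rule ccontr)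
    assume "\<not> t \<le> x"
    then have "\<Phi> x \<le> \<Phi> t" by (intro monoD[OF assms(1)]) simp
    with assms(2) that show False by simp
  qed
  then show ?thesis using False unfolding young_inv_def by (auto intro: Inf_greatest)
qed (simp add: young_inv_def)

text \<open>Since \<open>\<Phi>\<close> tends to 0 at 0, some positive argument still has a value
  below \<open>u\<close>.\<close>

lemma young_inv_pos:
  assumes Y: "young_function \<Phi>" and "0 < u"
  shows "0 < young_inv \<Phi> u"
proof -
  have "(\<Phi> \<longlongrightarrow> 0) (at_right 0)" using Y by (simp add: young_function_def)
  then have "eventually (\<lambda>t. \<Phi> t < u) (at_right 0)"
    using \<open>0 < u\<close> by (rule order_tendstoD)
  then obtain b where "b > 0" "\<And>t. t > 0 \<Longrightarrow> t < b \<Longrightarrow> \<Phi> t < u"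
    using eventually_at_right[of "0::ennreal" 1] by auto
  moreover obtain t where "0 < t" "t < b" using \<open>b > 0\<close> dense by blast
  ultimately have "\<Phi> t \<le> u" by (simp add: less_imp_le)
  then have "t \<le> young_inv \<Phi> u" using Y by (intro le_young_inv) (auto simp: young_function_def)
  with \<open>0 < t\<close> show ?thesis by simp
qed

text \<open>\<open>\<Phi>\<close> exceeds \<open>u\<close> at a finite argument: by the limit at
  infinity if \<open>young_b \<Phi> = \<infinity>\<close>, and otherwise because
  \<open>\<Phi>\<close> takes the value \<open>\<infinity>\<close> at a finite point.\<close>

lemma young_inv_finite:
  assumes Y: "young_function \<Phi>" and "u < \<infinity>"
  shows "young_inv \<Phi> u < \<infinity>"
proof -
  have "\<exists>t<\<infinity>. u < \<Phi> t"
  proof (cases "young_b \<Phi> = \<infinity>")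
    case True
    then have "(\<Phi> \<longlongrightarrow> \<infinity>) (at_left \<infinity>)" using Y by (simp add: young_function_def)
    then have "eventually (\<lambda>t. u < \<Phi> t) (at_left \<infinity>)"
      using \<open>u < \<infinity>\<close> by (rule order_tendstoD)
    then obtain b where "b < \<infinity>" "\<And>t. b < t \<Longrightarrow> t < \<infinity> \<Longrightarrow> u < \<Phi> t"
      using eventually_at_left[of "0::ennreal" "\<infinity>"] by auto
    moreover obtain t where "b < t" "t < \<infinity>" using \<open>b < \<infinity>\<close> dense by blast
    ultimately show ?thesis by blast
  next
    case False
    then have "young_b \<Phi> < \<infinity>" by (simp add: less_top[symmetric])
    then obtain t where "\<Phi> t = \<infinity>" "t < \<infinity>"
      unfolding young_b_def Inf_less_iff by auto
    with \<open>u < \<infinity>\<close> show ?thesis by metis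
  qed
  then obtain t where "t < \<infinity>" "u < \<Phi> t" by blast
  then have "young_inv \<Phi> u \<le> t" using \<open>u < \<infinity>\<close>
    unfolding young_inv_def by (auto intro: Inf_lower)
  with \<open>t < \<infinity>\<close> show ?thesis by simp
qed

lemma young_inv_le_b:
  assumes "u < \<infinity>"
  shows "young_inv \<Phi> u \<le> young_b \<Phi>"
  using assms unfolding young_inv_def young_b_def by (auto intro!: Inf_superset_mono)

text \<open>Convexity on the segment from 0 to \<open>x\<close>, with \<open>\<Phi> 0 = 0\<close>.
  Finiteness of \<open>\<Phi>\<close> below \<open>young_b \<Phi>\<close> carries the real
  inequality over to \<open>ennreal\<close>.\<close>

lemma young_convex_scale:
  assumes Y: "young_function \<Phi>" and a: "0 \<le> a" "a \<le> 1" and "0 \<le> x" and b: "ennreal x < young_b \<Phi>"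
  shows "\<Phi> (ennreal (a * x)) \<le> ennreal a * \<Phi> (ennreal x)"
proof -
  have fin: "\<Phi> t < \<infinity>" if "t < young_b \<Phi>" for t
  proof (rule ccontr)
    assume "\<not> \<Phi> t < \<infinity>"
    then have "\<Phi> t = \<infinity>" by (simp add: less_top[symmetric])
    then have "young_b \<Phi> \<le> t" unfolding young_b_def by (auto intro: Inf_lower)
    with that show False by simp
  qed
  have le: "ennreal (a * x) \<le> ennreal x"
    using a \<open>0 \<le> x\<close> by (intro ennreal_leI) (simp add: mult_left_le_one_le)
  let ?f = "\<lambda>t. enn2real (\<Phi> (ennreal t))"
  have c: "convex_on {t. 0 \<le> t \<and> ennreal t < young_b \<Phi>} ?f" and z: "\<Phi> 0 = 0" and p: "0 < young_b \<Phi>"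
    using Y by (auto simp: young_function_def)
  have "?f ((1 - a) *\<^sub>R 0 + a *\<^sub>R x) \<le> (1 - a) * ?f 0 + a * ?f x"
    by (rule convex_onD[OF c]) (use a \<open>0 \<le> x\<close> b p in auto)
  then have f: "?f (a * x) \<le> a * ?f x" using z by simp
  have "\<Phi> (ennreal (a * x)) = ennreal (?f (a * x))"
    using fin[OF le_less_trans[OF le b]] by (simp only: ennreal_enn2real infinity_ennreal_def)
  also have "\<dots> \<le> ennreal (a * ?f x)" using f by (rule ennreal_leI)
  also have "\<dots> = ennreal a * ennreal (?f x)" using a by (simp only: ennreal_mult enn2real_nonneg)
  also have "ennreal (?f x) = \<Phi> (ennreal x)"
    using fin[OF b] by (simp only: ennreal_enn2real infinity_ennreal_def)
  finally show ?thesis .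
qed

text \<open>Convexity sharpens \<open>young_le_of_less_inv\<close>: shrinking the threshold by
  \<open>a\<close> gains the same factor in the bound. This makes the series in the gliding hump
  geometric.\<close>

lemma young_le_scaled:
  assumes Y: "young_function \<Phi>" and a: "0 < a" "a \<le> 1" and "0 \<le> x" and u: "u < \<infinity>"
    and x: "ennreal x < ennreal a * young_inv \<Phi> u"
  shows "\<Phi> (ennreal x) \<le> ennreal a * u"
proof -
  have *: "ennreal (x / a) < young_inv \<Phi> u"
  proof (rule ccontr)
    assume "\<not> ?thesis"
    then have "ennreal a * young_inv \<Phi> u \<le> ennreal a * ennreal (x / a)"
      by (intro mult_left_mono) auto
    also have "\<dots> = ennreal x" using a \<open>0 \<le> x\<close> by (simp flip: ennreal_mult)
    finally show False using x by simp
  qed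
  then have "ennreal (x / a) < young_b \<Phi>" using young_inv_le_b[OF u] by (rule less_le_trans)
  then have "\<Phi> (ennreal (a * (x / a))) \<le> ennreal a * \<Phi> (ennreal (x / a))"
    using a \<open>0 \<le> x\<close> by (intro young_convex_scale[OF Y]) auto
  also have "\<dots> \<le> ennreal a * u"
    using young_le_of_less_inv[OF *] by (intro mult_left_mono) auto
  finally show ?thesis using a by simp
qed

text \<open>Convexity of \<open>\<Phi>\<close> limits its inverse to linear growth: dividing the
  argument by \<open>A\<close> divides the value of \<open>\<Phi>\<close> by at least
  \<open>A\<close>. It lets a finite modular bound cost only a constant factor.\<close>

lemma young_inv_scale:
  assumes Y: "young_function \<Phi>" and A: "1 \<le> A" and u: "u < \<infinity>"
  shows "young_inv \<Phi> (ennreal A * u) \<le> ennreal A * young_inv \<Phi> u"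
proof (rule dense_le)
  fix y assume y: "y < young_inv \<Phi> (ennreal A * u)"
  have fin: "ennreal A * u < \<infinity>" using u by (simp add: ennreal_mult_less_top)
  have "y < \<infinity>" using y young_inv_finite[OF Y fin] by (rule less_trans)
  then obtain x where x: "0 \<le> x" "y = ennreal x" by (cases y) auto
  have "ennreal x < young_b \<Phi>"
    using y x young_inv_le_b[OF fin, of \<Phi>] by (simp add: less_le_trans)
  then have "\<Phi> (ennreal (inverse A * x)) \<le> ennreal (inverse A) * \<Phi> (ennreal x)"
    using A x by (intro young_convex_scale[OF Y]) (auto simp: field_simps)
  also have "\<dots> \<le> ennreal (inverse A) * (ennreal A * u)"
    using young_le_of_less_inv[OF y] x by (intro mult_left_mono) auto
  also have "\<dots> = u" using A by (simp add: mult.assoc[symmetric] flip: ennreal_mult)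
  finally have "ennreal (inverse A * x) \<le> young_inv \<Phi> u"
    using Y by (intro le_young_inv) (auto simp: young_function_def)
  then have "ennreal A * ennreal (inverse A * x) \<le> ennreal A * young_inv \<Phi> u"
    by (intro mult_left_mono) auto
  moreover have "ennreal A * ennreal (inverse A * x) = y"
    using A x by (simp flip: ennreal_mult)
  ultimately show "y \<le> ennreal A * young_inv \<Phi> u" by simp
qed

section \<open>Division by a positive finite measure\<close>

lemma ennreal_inverse_bounds:
  fixes m :: ennreal
  assumes "0 < m" "m < \<infinity>"
  shows "0 < inverse m" "inverse m < \<infinity>"
  using assms ennreal_inverse_eq_top_iff[of m]
  by (auto simp: ennreal_inverse_positive less_top[symmetric])

lemma ennreal_mult_le_iff_le_inverse:
  fixes a b m :: ennreal
  assumes "0 < m" "m < \<infinity>"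
  shows "a * m \<le> b \<longleftrightarrow> a \<le> b * inverse m"
proof -
  have m: "m * inverse m = 1" "inverse m * m = 1"
    using assms by (simp_all add: divide_ennreal_def[symmetric] mult.commute less_top[symmetric])
  show ?thesis
  proof
    assume "a * m \<le> b"
    then have "a * m * inverse m \<le> b * inverse m" by (intro mult_right_mono) auto
    then show "a \<le> b * inverse m" using m by (simp add: mult.assoc)
  next
    assume "a \<le> b * inverse m"
    then have "a * m \<le> b * inverse m * m" by (intro mult_right_mono) auto
    then show "a * m \<le> b" using m by (simp add: mult.assoc)
  qed
qed

lemmas ennreal_mult_le_one_iff = ennreal_mult_le_iff_le_inverse[where b = 1, unfolded mult_1]

section \<open>From the indicator condition to the modular of the third space\<close>

text \<open>What a multiplier bound \<open>K\<close> yields on indicators, cleared of denominators.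
  It is the common interface of two sources of \<open>K\<close>: a given operator bound, which is
  quantitative, and mere membership in \<open>PWM\<close>, which only gives some
  \<open>K\<close>.\<close>

definition indicator_test ::
  "'a measure \<Rightarrow> (ennreal \<Rightarrow> ennreal) \<Rightarrow> (ennreal \<Rightarrow> ennreal) \<Rightarrow> real \<Rightarrow> ('a \<Rightarrow> 'k::real_normed_field) \<Rightarrow> bool"
  where "indicator_test M \<Phi> \<Psi> K g \<longleftrightarrow>
    (\<forall>t>0. \<forall>E\<in>sets M. 0 < emeasure M E \<longrightarrow> emeasure M E < \<infinity> \<longrightarrow> (\<forall>x\<in>E. t < norm (g x)) \<longrightarrow>
      ennreal t * young_inv \<Phi> (inverse (emeasure M E))
        \<le> ennreal K * young_inv \<Psi> (inverse (emeasure M E)))"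

lemma weak_modular_le_iff:
  "weak_modular M \<Phi> f \<le> A \<longleftrightarrow> (\<forall>t>0. \<Phi> (ennreal t) * emeasure M {x \<in> space M. t < norm (f x)} \<le> A)"
  unfolding weak_modular_def distribution_fun_def by (auto simp: SUP_le_iff)

text \<open>Sigma-finiteness exhausts each superlevel set by sets of finite measure; on each of them
  the test combined with the inequality between the inverses bounds the level, and continuity from
  below passes to the limit.\<close>

lemma weak_modular_indicator_test:
  fixes g :: "'a \<Rightarrow> 'k::{real_normed_field, second_countable_topology}"
  assumes "sigma_finite_measure M" and g[measurable]: "g \<in> borel_measurable M"
    and Y1: "young_function \<Phi>1" and Y3: "young_function \<Phi>3"
    and "C > 0" "K > 0"
    and inv: "\<And>u::ennreal. 0 < u \<Longrightarrow> u < \<infinity> \<Longrightarrow>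
           young_inv \<Phi>2 u \<le> ennreal C * young_inv \<Phi>1 u * young_inv \<Phi>3 u"
    and T: "indicator_test M \<Phi>1 \<Phi>2 K g"
  shows "weak_modular M \<Phi>3 (\<lambda>x. g x /\<^sub>R (C * K)) \<le> 1"
  unfolding weak_modular_le_iff
proof (intro allI impI)
  interpret sigma_finite_measure M by fact
  fix s :: real assume "s > 0"
  obtain W :: "nat \<Rightarrow> 'a set" where W: "range W \<subseteq> sets M" "(\<Union>i. W i) = space M"
      "\<And>i. emeasure M (W i) \<noteq> \<infinity>" "incseq W"
    using sigma_finite_incseq by blast
  note [measurable] = range_subsetD[OF W(1)]
  \<comment> \<open>Intersecting with \<open>W k\<close> makes the measure finite. The excess
    \<open>1 / Suc k\<close> provides the strict inequality for \<open>young_le_of_less_inv\<close>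
    and tends to 0, so that the union is the full superlevel set.\<close>
  define E where "E k = {x \<in> W k. C * K * (s + 1 / Suc k) < norm (g x)}" for k
  have E[measurable]: "E k \<in> sets M" for k
  proof -
    have "E k = W k \<inter> {x \<in> space M. C * K * (s + 1 / Suc k) < norm (g x)}"
      using sets.sets_into_space[OF range_subsetD[OF W(1)]] by (auto simp: E_def)
    then show ?thesis by simp
  qed
  have bound: "\<Phi>3 (ennreal s) * emeasure M (E k) \<le> 1" for k
  proof (cases "emeasure M (E k) = 0")
    case False
    let ?m = "emeasure M (E k)" and ?s = "s + 1 / Suc k"
    have m: "0 < ?m" "?m < \<infinity>"
    proof -
      show "0 < ?m" using False by (simp add: zero_less_iff_neq_zero)
      have "?m \<le> emeasure M (W k)" by (rule emeasure_mono) (auto simp: E_def)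
      then show "?m < \<infinity>" using W(3)[of k] by (auto simp: less_top[symmetric] top_unique)
    qed
    then have u: "0 < inverse ?m" "inverse ?m < \<infinity>"
      using ennreal_inverse_bounds by auto
    have s: "0 < ?s" using \<open>s > 0\<close> by (rule add_pos_pos) simp
    let ?p = "young_inv \<Phi>1 (inverse ?m)" and ?q = "young_inv \<Phi>3 (inverse ?m)"
    have p: "0 < ?p" "?p < \<infinity>" using young_inv_pos[OF Y1 u(1)] young_inv_finite[OF Y1 u(2)] by auto
    \<comment> \<open>Testing at level \<open>C * K * ?s\<close> produces the factor
      \<open>C * K * ?p\<close> on both sides once the inequality between the inverses is inserted;
      being positive and finite, it cancels and leaves \<open>?s \<le> ?q\<close>.\<close>
    have "ennreal (C * K * ?s) * ?p \<le> ennreal K * young_inv \<Phi>2 (inverse ?m)"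
    proof (rule T[unfolded indicator_test_def, rule_format, OF _ E m])
      show "0 < C * K * ?s"
        using \<open>C > 0\<close> \<open>K > 0\<close> s by simp
      show "C * K * ?s < norm (g x)" if "x \<in> E k" for x using that by (simp add: E_def)
    qed
    also have "\<dots> \<le> ennreal K * (ennreal C * ?p * ?q)"
      by (intro mult_left_mono inv u) auto
    finally have "(ennreal (C * K) * ?p) * ennreal ?s \<le> (ennreal (C * K) * ?p) * ?q"
      using \<open>C > 0\<close> \<open>K > 0\<close> s
      by (simp only: ennreal_mult mult_pos_pos less_imp_le) (simp only: ac_simps)
    moreover have "ennreal (C * K) * ?p \<noteq> 0" "ennreal (C * K) * ?p \<noteq> top"
      using p \<open>C > 0\<close> \<open>K > 0\<close> by (auto simp: ennreal_mult_eq_top_iff)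
    ultimately have "ennreal ?s \<le> ?q" by (metis ennreal_mult_le_mult_iff)
    moreover have "ennreal s < ennreal ?s" using s by (intro ennreal_lessI) simp_all
    ultimately have "ennreal s < ?q" by simp
    then have "\<Phi>3 (ennreal s) \<le> inverse ?m" by (rule young_le_of_less_inv)
    then show ?thesis using ennreal_mult_le_one_iff[OF m] by blast
  qed auto
  have inc: "incseq E"
  proof (rule incseq_SucI, rule subsetI)
    fix k x assume x: "x \<in> E k"
    have "C * K * (s + 1 / Suc (Suc k)) \<le> C * K * (s + 1 / Suc k)"
      using \<open>C > 0\<close> \<open>K > 0\<close> by (intro mult_left_mono add_left_mono) (auto simp: frac_le)
    then show "x \<in> E (Suc k)" using x incseqD[OF W(4), of k "Suc k"] by (auto simp: E_def)
  qed
  have UN: "(\<Union>k. E k) = {x \<in> space M. s < norm (g x /\<^sub>R (C * K))}"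
  proof (intro equalityI subsetI)
    fix x assume "x \<in> (\<Union>k. E k)"
    then obtain k where k: "x \<in> W k" "C * K * (s + 1 / Suc k) < norm (g x)" by (auto simp: E_def)
    have "C * K * s < C * K * (s + 1 / Suc k)" using \<open>C > 0\<close> \<open>K > 0\<close> by simp
    with k(2) have "C * K * s < norm (g x)" by simp
    moreover have "x \<in> space M" using k(1) W(2) by blast
    ultimately show "x \<in> {x \<in> space M. s < norm (g x /\<^sub>R (C * K))}"
      using \<open>C > 0\<close> \<open>K > 0\<close> by (simp add: field_simps)
  next
    fix x assume "x \<in> {x \<in> space M. s < norm (g x /\<^sub>R (C * K))}"
    then have x: "x \<in> space M" "s < norm (g x) / (C * K)"
      using \<open>C > 0\<close> \<open>K > 0\<close> by (simp_all add: field_simps)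
    obtain i where i: "x \<in> W i" using x W(2) by blast
    obtain j where j: "1 / Suc j < norm (g x) / (C * K) - s"
      using x(2) nat_approx_posE[of "norm (g x) / (C * K) - s"] by auto
    \<comment> \<open>Both \<open>W\<close> and the shrinking excess are monotone in the index, so
      the larger index meets both requirements.\<close>
    define k where "k = max i j"
    have "1 / real (Suc k) \<le> 1 / real (Suc j)" by (auto simp: k_def frac_le)
    with j have "s + 1 / Suc k < norm (g x) / (C * K)" by simp
    then have "C * K * (s + 1 / Suc k) < norm (g x)"
      using \<open>C > 0\<close> \<open>K > 0\<close> by (simp add: pos_less_divide_eq mult.commute)
    moreover have "x \<in> W k" using i incseqD[OF W(4), of i k] by (auto simp: k_def)
    ultimately show "x \<in> (\<Union>k. E k)" by (auto simp: E_def)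
  qed
  have "emeasure M {x \<in> space M. s < norm (g x /\<^sub>R (C * K))} = (SUP k. emeasure M (E k))"
    unfolding UN[symmetric] using inc E by (intro SUP_emeasure_incseq[symmetric]) auto
  then show "\<Phi>3 (ennreal s) * emeasure M {x \<in> space M. s < norm (g x /\<^sub>R (C * K))} \<le> 1"
    using bound by (simp only: SUP_mult_left_ennreal SUP_le_iff) blast
qed

section \<open>Testing an operator bound on indicator functions\<close>

lemma weak_orlicz_norm_le:
  assumes "0 < l" "weak_modular M \<Phi> (\<lambda>x. f x /\<^sub>R l) \<le> 1"
  shows "weak_orlicz_norm M \<Phi> f \<le> ennreal l"
  unfolding weak_orlicz_norm_def using assms by (auto intro: Inf_lower)

text \<open>The superlevel sets are \<open>E\<close> below the height \<open>r\<close> and empty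
  from \<open>r\<close> on, so only levels \<open>t < r\<close> count, and these lie strictly below
  the inverse.\<close>

lemma weak_modular_indicator_le:
  fixes h :: "'a \<Rightarrow> 'k::real_normed_field"
  assumes E: "E \<in> sets M" "0 < emeasure M E" "emeasure M E < \<infinity>"
    and h: "\<And>x. norm (h x) = r * indicator E x" and r: "ennreal r \<le> young_inv \<Phi> (inverse (emeasure M E))"
  shows "weak_modular M \<Phi> h \<le> 1"
  unfolding weak_modular_le_iff
proof (intro allI impI)
  fix t :: real assume "0 < t"
  show "\<Phi> (ennreal t) * emeasure M {x \<in> space M. t < norm (h x)} \<le> 1"
  proof (cases "t < r")
    case True
    then have "ennreal t < ennreal r" using \<open>0 < t\<close> by (intro ennreal_lessI) auto
    then have "ennreal t < young_inv \<Phi> (inverse (emeasure M E))" using r by (rule less_le_trans)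
    then have "\<Phi> (ennreal t) * emeasure M E \<le> 1"
      using ennreal_mult_le_one_iff[OF E(2,3)] young_le_of_less_inv by blast
    moreover have "{x \<in> space M. t < norm (h x)} = E"
      using True \<open>0 < t\<close> sets.sets_into_space[OF E(1)] by (auto simp: h indicator_def split: if_splits)
    ultimately show ?thesis by simp
  next
    case False
    then have "{x \<in> space M. t < norm (h x)} = {}"
      using \<open>0 < t\<close> by (auto simp: h indicator_def)
    then show ?thesis by (simp only: emeasure_empty mult_zero_right zero_le)
  qed
qed

text \<open>With \<open>p\<close> and \<open>q\<close> the values of the two inverses, the indicator
  \<open>f\<close> of \<open>E\<close> has quasi-norm at most \<open>1 / p\<close> and
  \<open>f * g\<close> at least \<open>t / q\<close>; the bound then reads
  \<open>t / q \<le> K / p\<close>.\<close>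

lemma indicator_test_of_bound:
  fixes g :: "'a \<Rightarrow> 'k::{real_normed_field, second_countable_topology}"
  assumes g[measurable]: "g \<in> borel_measurable M"
    and Y1: "young_function \<Phi>1" and Y2: "young_function \<Phi>2" and "K \<ge> 0"
    and bd: "\<And>f. f \<in> weak_orlicz M \<Phi>1 \<Longrightarrow>
       weak_orlicz_norm M \<Phi>2 (\<lambda>x. f x * g x) \<le> ennreal K * weak_orlicz_norm M \<Phi>1 f"
  shows "indicator_test M \<Phi>1 \<Phi>2 K g"
  unfolding indicator_test_def
proof (intro allI ballI impI)
  fix t :: real and E
  assume "0 < t" and E: "E \<in> sets M" "0 < emeasure M E" "emeasure M E < \<infinity>"
    and gt: "\<forall>x\<in>E. t < norm (g x)"
  let ?u = "inverse (emeasure M E)"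
  have u: "0 < ?u" "?u < \<infinity>"
    using E ennreal_inverse_bounds by auto
  obtain p where p: "0 < p" "young_inv \<Phi>1 ?u = ennreal p"
    using young_inv_pos[OF Y1 u(1)] young_inv_finite[OF Y1 u(2)] by (cases "young_inv \<Phi>1 ?u") auto
  obtain q where q: "0 < q" "young_inv \<Phi>2 ?u = ennreal q"
    using young_inv_pos[OF Y2 u(1)] young_inv_finite[OF Y2 u(2)] by (cases "young_inv \<Phi>2 ?u") auto
  define f :: "'a \<Rightarrow> 'k" where "f x = of_real (indicator E x)" for x
  have [measurable]: "f \<in> borel_measurable M" unfolding f_def using E(1) by measurable
  have mod: "weak_modular M \<Phi>1 (\<lambda>x. p *\<^sub>R f x) \<le> 1"
    by (rule weak_modular_indicator_le[OF E, where r = p]) (use p in \<open>auto simp: f_def\<close>)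
  then have "f \<in> weak_orlicz M \<Phi>1"
    using p(1) unfolding weak_orlicz_def by (auto intro!: exI[of _ p] simp: le_less_trans)
  then have "weak_orlicz_norm M \<Phi>2 (\<lambda>x. f x * g x) \<le> ennreal K * weak_orlicz_norm M \<Phi>1 f"
    by (rule bd)
  also have "weak_orlicz_norm M \<Phi>1 f \<le> ennreal (inverse p)"
    using mod p by (intro weak_orlicz_norm_le) auto
  finally have 1: "weak_orlicz_norm M \<Phi>2 (\<lambda>x. f x * g x) \<le> ennreal K * ennreal (inverse p)"
    by (simp add: mult_left_mono)
  have "ennreal (t / q) \<le> weak_orlicz_norm M \<Phi>2 (\<lambda>x. f x * g x)"
    unfolding weak_orlicz_norm_def
  \<comment> \<open>For an admissible \<open>l\<close>, the level \<open>t / l\<close> is strictly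
    exceeded on all of \<open>E\<close>, so the modular bound forces
    \<open>t / l \<le> q\<close>.\<close>
  proof (rule Inf_greatest, clarify)
    fix l :: real assume "0 < l" and l: "weak_modular M \<Phi>2 (\<lambda>x. (f x * g x) /\<^sub>R l) \<le> 1"
    have [measurable]: "(\<lambda>x. (f x * g x) /\<^sub>R l) \<in> borel_measurable M" by measurable
    have "{x \<in> space M. t / l < norm ((f x * g x) /\<^sub>R l)} \<in> sets M" by measurable
    then have "\<Phi>2 (ennreal (t / l)) * emeasure M E
        \<le> \<Phi>2 (ennreal (t / l)) * emeasure M {x \<in> space M. t / l < norm ((f x * g x) /\<^sub>R l)}"
      using gt \<open>0 < l\<close> sets.sets_into_space[OF E(1)]
      by (intro mult_left_mono emeasure_mono subsetI) (auto simp: f_def norm_mult field_simps)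
    also have "\<dots> \<le> 1" using l \<open>0 < t\<close> \<open>0 < l\<close> unfolding weak_modular_le_iff by simp
    finally have "\<Phi>2 (ennreal (t / l)) \<le> ?u" using ennreal_mult_le_one_iff[OF E(2,3)] by blast
    then have "ennreal (t / l) \<le> ennreal q"
      using Y2 unfolding q(2)[symmetric] by (intro le_young_inv) (auto simp: young_function_def)
    then show "ennreal (t / q) \<le> ennreal l"
      using q \<open>0 < l\<close> by (intro ennreal_leI) (simp add: field_simps)
  qed
  also note 1
  also have "ennreal K * ennreal (inverse p) = ennreal (K / p)"
    using p \<open>K \<ge> 0\<close> by (simp add: divide_inverse flip: ennreal_mult)
  finally have "t / q \<le> K / p" using p \<open>K \<ge> 0\<close> by simp
  then have "t * p \<le> K * q" using p q by (simp add: field_simps)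
  then show "ennreal t * young_inv \<Phi>1 ?u \<le> ennreal K * young_inv \<Phi>2 ?u"
    unfolding p q using p q \<open>0 < t\<close> \<open>K \<ge> 0\<close> by (simp flip: ennreal_mult)
qed

section \<open>Existence of a constant for every multiplier\<close>

text \<open>
  Gliding hump: if \<open>g\<close> failed every test, with constants \<open>4 ^ n\<close> on sets \<open>E n\<close>, then the supremum of
  \<open>2 ^ (-n) * young_inv \<Phi>1 (1 / emeasure M (E n))\<close> times the indicator of \<open>E n\<close> would lie in the
  first space (its modular is dominated by a geometric series, by convexity) while its product with
  \<open>g\<close> would not lie in the second. This replaces the closed graph theorem.
\<close>

lemma exists_indicator_test:
  fixes g :: "'a \<Rightarrow> 'k::{real_normed_field, second_countable_topology}"
  assumes Y1: "young_function \<Phi>1" and Y2: "young_function \<Phi>2"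
    and g: "g \<in> PWM M (weak_orlicz M \<Phi>1) (weak_orlicz M \<Phi>2)"
  shows "\<exists>K>0. indicator_test M \<Phi>1 \<Phi>2 K g"
proof (rule ccontr)
  assume "\<not> ?thesis"
  \<comment> \<open>The factor \<open>4 ^ n\<close> is split into two factors \<open>2 ^ n\<close>:
    one pays for the decay of the heights \<open>c n\<close>, the other remains to make the product
    with \<open>g\<close> unbounded.\<close>
  then have not_test: "\<not> indicator_test M \<Phi>1 \<Phi>2 (4 ^ n) g" for n :: nat by simp
  have "\<exists>t E. 0 < t \<and> E \<in> sets M \<and> 0 < emeasure M E \<and> emeasure M E < \<infinity> \<and> (\<forall>x\<in>E. t < norm (g x)) \<and>
      ennreal (4 ^ n) * young_inv \<Phi>2 (inverse (emeasure M E))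
        < ennreal t * young_inv \<Phi>1 (inverse (emeasure M E))" for n :: nat
    using not_test[of n] unfolding indicator_test_def not_le[symmetric] by blast
  then obtain t E where t: "\<And>n::nat. 0 < t n" and E[measurable]: "\<And>n. E n \<in> sets M"
    and m: "\<And>n. 0 < emeasure M (E n)" "\<And>n. emeasure M (E n) < \<infinity>"
    and gt: "\<And>n x. x \<in> E n \<Longrightarrow> t n < norm (g x)"
    and big: "\<And>n. ennreal (4 ^ n) * young_inv \<Phi>2 (inverse (emeasure M (E n)))
        < ennreal (t n) * young_inv \<Phi>1 (inverse (emeasure M (E n)))"
    by metis
  define u where "u n = inverse (emeasure M (E n))" for n
  have u: "0 < u n" "u n < \<infinity>" and u_m: "u n * emeasure M (E n) \<le> 1" for n
    using ennreal_inverse_bounds[OF m] ennreal_mult_le_one_iff[OF m] by (auto simp: u_def)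
  define p where "p n = enn2real (young_inv \<Phi>1 (u n))" for n
  define q where "q n = enn2real (young_inv \<Phi>2 (u n))" for n
  have p: "young_inv \<Phi>1 (u n) = ennreal (p n)" "0 < p n" for n
    using young_inv_pos[OF Y1 u(1)[of n]] young_inv_finite[OF Y1 u(2)[of n]]
    by (auto simp: p_def enn2real_positive_iff)
  have q: "young_inv \<Phi>2 (u n) = ennreal (q n)" "0 < q n" for n
    using young_inv_pos[OF Y2 u(1)[of n]] young_inv_finite[OF Y2 u(2)[of n]]
    by (auto simp: q_def enn2real_positive_iff)
  have pq: "4 ^ n * q n < t n * p n" for n
  proof -
    have "ennreal (4 ^ n * q n) < ennreal (t n * p n)"
      using big[of n] p(2)[of n] q(2)[of n] t[of n]
      by (simp add: p(1) q(1) ennreal_mult flip: u_def)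
    then show ?thesis using q(2)[of n] by (simp add: ennreal_less_iff)
  qed
  define c where "c n = (1 / 2) ^ n * p n" for n
  have c: "0 < c n" for n using p by (simp add: c_def)
  \<comment> \<open>A supremum rather than a sum: its superlevel set is the union of those of the
    pieces, so the distribution functions simply add. It may be infinite, hence the type
    \<open>ennreal\<close>.\<close>
  define F :: "'a \<Rightarrow> ennreal" where "F x = (SUP n. ennreal (c n) * indicator (E n) x)" for x
  have [measurable]: "F \<in> borel_measurable M" unfolding F_def by measurable
  have level: "\<Phi>1 (ennreal s) * emeasure M {x \<in> space M. ennreal s < F x} \<le> 2" if "0 < s" for s
  proof -
    \<comment> \<open>\<open>A n\<close> is the superlevel set of the \<open>n\<close>-th piece at
      level \<open>s\<close>.\<close>
    define A where "A n = (if s < c n then E n else {})" for n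
    have A[measurable]: "A n \<in> sets M" for n by (simp add: A_def)
    have "{x \<in> space M. ennreal s < F x} \<subseteq> (\<Union>n. A n)"
    proof clarify
      fix x assume "ennreal s < F x"
      then obtain n where n: "ennreal s < ennreal (c n) * indicator (E n) x"
        unfolding F_def less_SUP_iff by blast
      then have "x \<in> E n" by (cases "x \<in> E n") auto
      with n \<open>0 < s\<close> have "x \<in> A n" by (simp add: A_def ennreal_less_iff)
      then show "x \<in> (\<Union>n. A n)" by blast
    qed
    then have "emeasure M {x \<in> space M. ennreal s < F x} \<le> emeasure M (\<Union>n. A n)"
      by (intro emeasure_mono) auto
    also have "\<dots> \<le> (\<Sum>n. emeasure M (A n))" by (intro emeasure_subadditive_countably) auto
    finally have "\<Phi>1 (ennreal s) * emeasure M {x \<in> space M. ennreal s < F x}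
        \<le> \<Phi>1 (ennreal s) * (\<Sum>n. emeasure M (A n))" by (intro mult_left_mono) auto
    also have "\<dots> = (\<Sum>n. \<Phi>1 (ennreal s) * emeasure M (A n))" by simp
    also have "\<dots> \<le> (\<Sum>n. ennreal ((1 / 2) ^ n))"
    proof (intro suminf_le)
      fix n
      show "\<Phi>1 (ennreal s) * emeasure M (A n) \<le> ennreal ((1 / 2) ^ n)"
      proof (cases "s < c n")
        case True
        \<comment> \<open>The height is \<open>(1 / 2) ^ n\<close> times the inverse at
          \<open>u n\<close>, so convexity yields a factor \<open>(1 / 2) ^ n\<close> in the modular
          of this piece.\<close>
        have "ennreal s < ennreal (c n)" using True \<open>0 < s\<close> by (simp add: ennreal_less_iff)
        also have "ennreal (c n) = ennreal ((1 / 2) ^ n) * young_inv \<Phi>1 (u n)"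
          unfolding p(1) c_def using p(2)[of n] by (intro ennreal_mult) auto
        finally have "\<Phi>1 (ennreal s) \<le> ennreal ((1 / 2) ^ n) * u n"
          using \<open>0 < s\<close> u(2) by (intro young_le_scaled[OF Y1]) (auto simp: power_le_one)
        then have "\<Phi>1 (ennreal s) * emeasure M (A n) \<le> ennreal ((1 / 2) ^ n) * u n * emeasure M (E n)"
          using True by (simp only: A_def if_True) (intro mult_right_mono, auto)
        also have "\<dots> \<le> ennreal ((1 / 2) ^ n) * 1"
          unfolding mult.assoc by (intro mult_left_mono u_m) simp
        finally show ?thesis by simp
      qed (simp add: A_def)
    qed auto
    also have "\<dots> = 2"
      by (subst suminf_ennreal_eq[where x = 2]) (use geometric_sums[of "1/2::real"] in auto)
    finally show ?thesis .
  qed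
  have F_fin: "emeasure M {x \<in> space M. F x = \<infinity>} = 0"
  proof (rule ccontr)
    let ?N = "{x \<in> space M. F x = \<infinity>}"
    assume N: "emeasure M ?N \<noteq> 0"
    \<comment> \<open>The set may have infinite measure; capping at 1 leaves a positive finite
      number to divide by.\<close>
    define m where "m = min 1 (emeasure M ?N)"
    have m: "0 < m" "m < \<infinity>" "m \<le> emeasure M ?N"
      using N by (auto simp: m_def zero_less_iff_neq_zero min_less_iff_disj)
    have "2 * inverse m < \<infinity>"
      using ennreal_inverse_bounds(2)[OF m(1,2)] by (simp add: ennreal_mult_less_top)
    then obtain y where y: "0 \<le> y" "young_inv \<Phi>1 (2 * inverse m) = ennreal y"
      using young_inv_finite[OF Y1, of "2 * inverse m"]
      by (cases "young_inv \<Phi>1 (2 * inverse m)") auto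
    \<comment> \<open>Every finite level is exceeded where \<open>F\<close> is infinite, so
      \<open>level\<close> applies at \<open>y + 1\<close>; it would put \<open>y + 1\<close> at or
      below the inverse value \<open>y\<close>.\<close>
    have "\<Phi>1 (ennreal (y + 1)) * m \<le> \<Phi>1 (ennreal (y + 1)) * emeasure M ?N"
      using m(3) by (intro mult_left_mono) auto
    also have "\<dots>
        \<le> \<Phi>1 (ennreal (y + 1)) * emeasure M {x \<in> space M. ennreal (y + 1) < F x}"
      by (intro mult_left_mono emeasure_mono) auto
    also have "\<dots> \<le> 2" using y by (intro level) auto
    finally have "\<Phi>1 (ennreal (y + 1)) \<le> 2 * inverse m"
      using ennreal_mult_le_iff_le_inverse[OF m(1,2)] by blast
    then have "ennreal (y + 1) \<le> ennreal y"
      using Y1 unfolding y(2)[symmetric] by (intro le_young_inv) (auto simp: young_function_def)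
    with y(1) show False by simp
  qed
  \<comment> \<open>\<open>enn2real\<close> sends \<open>\<infinity>\<close> to 0, which by
    \<open>F_fin\<close> changes \<open>F\<close> only on a null set.\<close>
  define f :: "'a \<Rightarrow> 'k" where "f x = of_real (enn2real (F x))" for x
  have [measurable]: "f \<in> borel_measurable M" unfolding f_def by measurable
  have norm_f: "norm (f x) = enn2real (F x)" for x by (simp add: f_def)
  have "weak_modular M \<Phi>1 (\<lambda>x. 1 *\<^sub>R f x) \<le> 2"
    unfolding weak_modular_le_iff
  proof (intro allI impI)
    fix s :: real assume "0 < s"
    have "{x \<in> space M. s < norm (1 *\<^sub>R f x)} \<subseteq> {x \<in> space M. ennreal s < F x}"
    proof clarify
      fix x assume "s < norm (1 *\<^sub>R f x)"
      then have "s < enn2real (F x)" by (simp add: norm_f)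
      then show "ennreal s < F x" using \<open>0 < s\<close>
        by (cases "F x") (auto simp: ennreal_less_iff)
    qed
    then have "\<Phi>1 (ennreal s) * emeasure M {x \<in> space M. s < norm (1 *\<^sub>R f x)}
        \<le> \<Phi>1 (ennreal s) * emeasure M {x \<in> space M. ennreal s < F x}"
      by (intro mult_left_mono emeasure_mono) auto
    also have "\<dots> \<le> 2" using \<open>0 < s\<close> by (rule level)
    finally show "\<Phi>1 (ennreal s) * emeasure M {x \<in> space M. s < norm (1 *\<^sub>R f x)} \<le> 2" .
  qed
  then have "weak_modular M \<Phi>1 (\<lambda>x. 1 *\<^sub>R f x) < \<infinity>" by (rule le_less_trans) simp
  then have "f \<in> weak_orlicz M \<Phi>1"
    unfolding weak_orlicz_def by (auto intro!: exI[of _ "1::real"])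
  then have "(\<lambda>x. f x * g x) \<in> weak_orlicz M \<Phi>2" using g by (auto simp: PWM_def)
  then obtain \<epsilon> where \<epsilon>: "0 < \<epsilon>" "weak_modular M \<Phi>2 (\<lambda>x. \<epsilon> *\<^sub>R (f x * g x)) < \<infinity>"
    unfolding weak_orlicz_def by auto
  \<comment> \<open>The maximum with 1 meets the requirement \<open>1 \<le> A\<close> of
    \<open>young_inv_scale\<close>.\<close>
  define A where "A = max 1 (enn2real (weak_modular M \<Phi>2 (\<lambda>x. \<epsilon> *\<^sub>R (f x * g x))))"
  have A: "1 \<le> A" "weak_modular M \<Phi>2 (\<lambda>x. \<epsilon> *\<^sub>R (f x * g x)) \<le> ennreal A"
  proof -
    show "1 \<le> A" by (simp add: A_def)
    have "weak_modular M \<Phi>2 (\<lambda>x. \<epsilon> *\<^sub>R (f x * g x))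
        = ennreal (enn2real (weak_modular M \<Phi>2 (\<lambda>x. \<epsilon> *\<^sub>R (f x * g x))))"
      using \<epsilon>(2) by (simp only: ennreal_enn2real infinity_ennreal_def)
    also have "\<dots> \<le> ennreal A" unfolding A_def by (intro ennreal_leI) simp
    finally show "weak_modular M \<Phi>2 (\<lambda>x. \<epsilon> *\<^sub>R (f x * g x)) \<le> ennreal A" .
  qed
  have [measurable]: "g \<in> borel_measurable M" using g by (simp add: PWM_def)
  have bound: "\<epsilon> * 2 ^ n \<le> A" for n
  proof -
    \<comment> \<open>On \<open>E n\<close>, off the null set, \<open>norm (f x * g x)\<close> is at
      least \<open>c n * t n\<close>, which exceeds \<open>2 ^ n * q n\<close> by \<open>pq\<close>.
      The modular bound in turn gives \<open>?s \<le> A * q n\<close>, and \<open>q n\<close>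
      cancels.\<close>
    let ?s = "\<epsilon> * (2 ^ n * q n)"
    have s: "0 < ?s" using \<epsilon>(1) q(2)[of n] by simp
    let ?S = "{x \<in> space M. ?s < norm (\<epsilon> *\<^sub>R (f x * g x))}"
    have S[measurable]: "?S \<in> sets M" by measurable
    have "E n \<subseteq> ?S \<union> {x \<in> space M. F x = \<infinity>}"
    proof (rule subsetI)
      fix x assume x: "x \<in> E n"
      have "x \<in> space M" using x sets.sets_into_space[OF E] by blast
      moreover have "?s < norm (\<epsilon> *\<^sub>R (f x * g x))" if "F x \<noteq> \<infinity>"
      proof -
        have "ennreal (c n) * indicator (E n) x \<le> F x" unfolding F_def by (rule SUP_upper) simp
        then have "ennreal (c n) \<le> F x" using x by simp
        then have cf: "c n \<le> norm (f x)"
          unfolding norm_f using that c[of n] by (cases "F x") auto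
        have "2 ^ n * q n = (1 / 2) ^ n * (4 ^ n * q n)"
          by (simp flip: power_mult_distrib mult.assoc)
        also have "\<dots> < (1 / 2) ^ n * (t n * p n)" using pq[of n] by (intro mult_strict_left_mono) auto
        also have "\<dots> = c n * t n" by (simp add: c_def)
        also have "\<dots> \<le> norm (f x) * norm (g x)"
          using cf gt[OF x] c[of n] t[of n] by (intro mult_mono) auto
        finally show ?thesis using \<epsilon>(1) by (simp add: norm_mult)
      qed
      ultimately show "x \<in> ?S \<union> {x \<in> space M. F x = \<infinity>}" by blast
    qed
    then have "emeasure M (E n) \<le> emeasure M (?S \<union> {x \<in> space M. F x = \<infinity>})"
      by (intro emeasure_mono) auto
    also have "\<dots> \<le> emeasure M ?S + emeasure M {x \<in> space M. F x = \<infinity>}"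
      by (intro emeasure_subadditive) auto
    also have "\<dots> = emeasure M ?S" using F_fin by simp
    finally have "\<Phi>2 (ennreal ?s) * emeasure M (E n) \<le> \<Phi>2 (ennreal ?s) * emeasure M ?S"
      by (intro mult_left_mono) auto
    also have "\<dots> \<le> ennreal A" using A(2) s unfolding weak_modular_le_iff by blast
    finally have "\<Phi>2 (ennreal ?s) \<le> ennreal A * u n"
      using ennreal_mult_le_iff_le_inverse[OF m] unfolding u_def by blast
    then have "ennreal ?s \<le> young_inv \<Phi>2 (ennreal A * u n)"
      using Y2 by (intro le_young_inv) (auto simp: young_function_def)
    also have "\<dots> \<le> ennreal A * young_inv \<Phi>2 (u n)" by (rule young_inv_scale[OF Y2 A(1) u(2)])
    also have "\<dots> = ennreal (A * q n)" unfolding q(1) using A(1) q(2)[of n] by (simp add: ennreal_mult)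
    finally have "?s \<le> A * q n" using A(1) q(2)[of n] by (simp add: ennreal_le_iff)
    then have "\<epsilon> * 2 ^ n * q n \<le> A * q n" by (simp only: mult.assoc)
    then show ?thesis using q(2)[of n] by simp
  qed
  obtain n where "A / \<epsilon> < 2 ^ n" using real_arch_pow[of 2 "A / \<epsilon>"] by auto
  then have "A < \<epsilon> * 2 ^ n" using \<epsilon>(1) by (simp add: field_simps)
  with bound[of n] show False by simp
qed

section \<open>The inclusion and the norm estimate\<close>

theorem theorem3p2:
  fixes M :: "'a measure"
    and \<Phi>1 \<Phi>2 \<Phi>3 :: "ennreal \<Rightarrow> ennreal"
    and C :: real
  assumes "complete_measure M" and "sigma_finite_measure M"
    and "young_function \<Phi>1" and "young_function \<Phi>2" and "young_function \<Phi>3"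
    and "C > 0"
    and "\<And>u::ennreal. 0 < u \<Longrightarrow> u < \<infinity> \<Longrightarrow>
           young_inv \<Phi>2 u \<le> ennreal C * young_inv \<Phi>1 u * young_inv \<Phi>3 u"
  shows "PWM M (weak_orlicz M \<Phi>1) (weak_orlicz M \<Phi>2)
           \<subseteq> (weak_orlicz M \<Phi>3 :: ('a \<Rightarrow> 'k::{real_normed_field, second_countable_topology}) set) \<and>
         (\<forall>g \<in> PWM M (weak_orlicz M \<Phi>1) (weak_orlicz M \<Phi>2 :: ('a \<Rightarrow> 'k) set).
            weak_orlicz_norm M \<Phi>3 g
              \<le> ennreal C * PWM_norm (weak_orlicz M \<Phi>1) (weak_orlicz_norm M \<Phi>1)
                               (weak_orlicz_norm M \<Phi>2) g)"
proof (intro conjI subsetI ballI)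
  fix g :: "'a \<Rightarrow> 'k"
  assume g: "g \<in> PWM M (weak_orlicz M \<Phi>1) (weak_orlicz M \<Phi>2)"
  then have gm: "g \<in> borel_measurable M" by (simp add: PWM_def)
  have modular: "weak_modular M \<Phi>3 (\<lambda>x. g x /\<^sub>R (C * K)) \<le> 1"
    if "0 < K" "indicator_test M \<Phi>1 \<Phi>2 K g" for K
    using assms(2,3,5,6,7) gm that by (intro weak_modular_indicator_test)
  \<comment> \<open>This \<open>K\<close> comes from the contradiction argument and is unrelated to
    the operator norm; it serves membership only.\<close>
  obtain K where K: "0 < K" "indicator_test M \<Phi>1 \<Phi>2 K g"
    using exists_indicator_test[OF assms(3,4) g] by blast
  have "weak_modular M \<Phi>3 (\<lambda>x. inverse (C * K) *\<^sub>R g x) < \<infinity>"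
    using modular[OF K] by (rule le_less_trans) simp
  moreover have "0 < inverse (C * K)" using K(1) \<open>C > 0\<close> by simp
  ultimately show "g \<in> weak_orlicz M \<Phi>3" unfolding weak_orlicz_def using gm by blast
next
  fix g :: "'a \<Rightarrow> 'k"
  assume g: "g \<in> PWM M (weak_orlicz M \<Phi>1) (weak_orlicz M \<Phi>2)"
  then have gm: "g \<in> borel_measurable M" by (simp add: PWM_def)
  have modular: "weak_modular M \<Phi>3 (\<lambda>x. g x /\<^sub>R (C * K)) \<le> 1"
    if "0 < K" "indicator_test M \<Phi>1 \<Phi>2 K g" for K
    using assms(2,3,5,6,7) gm that by (intro weak_modular_indicator_test)
  let ?N = "weak_orlicz_norm M \<Phi>3 g"
  have *: "?N \<le> ennreal C * ennreal K"
    if "0 \<le> K" and bd: "\<forall>f\<in>weak_orlicz M \<Phi>1.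
      weak_orlicz_norm M \<Phi>2 (\<lambda>x. f x * g x) \<le> ennreal K * weak_orlicz_norm M \<Phi>1 f" for K
  proof (rule ennreal_le_epsilon)
    fix e :: real assume "0 < e"
    \<comment> \<open>\<open>K\<close> may be 0, while \<open>modular\<close> takes a positive
      constant; the increment \<open>e / C\<close> becomes exactly \<open>e\<close> after
      multiplication by \<open>C\<close>.\<close>
    define L where "L = K + e / C"
    have L: "0 < L" "K \<le> L" using \<open>0 < e\<close> \<open>C > 0\<close> \<open>0 \<le> K\<close> by (auto simp: L_def add_nonneg_pos)
    have "indicator_test M \<Phi>1 \<Phi>2 L g"
    proof (rule indicator_test_of_bound[OF gm assms(3,4)])
      fix f :: "'a \<Rightarrow> 'k" assume "f \<in> weak_orlicz M \<Phi>1"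
      then have "weak_orlicz_norm M \<Phi>2 (\<lambda>x. f x * g x) \<le> ennreal K * weak_orlicz_norm M \<Phi>1 f"
        using bd by blast
      also have "\<dots> \<le> ennreal L * weak_orlicz_norm M \<Phi>1 f"
        using L by (intro mult_right_mono ennreal_leI) auto
      finally show "weak_orlicz_norm M \<Phi>2 (\<lambda>x. f x * g x) \<le> ennreal L * weak_orlicz_norm M \<Phi>1 f" .
    qed (use L in simp)
    then have "?N \<le> ennreal (C * L)"
      using modular L \<open>C > 0\<close> by (intro weak_orlicz_norm_le) auto
    also have "C * L = C * K + e" using \<open>C > 0\<close> by (simp add: L_def field_simps)
    also have "ennreal (C * K + e) = ennreal C * ennreal K + ennreal e"
      using \<open>C > 0\<close> \<open>0 \<le> K\<close> \<open>0 < e\<close> by (simp add: ennreal_mult)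
    finally show "?N \<le> ennreal C * ennreal K + ennreal e" .
  qed
  show "?N \<le> ennreal C * PWM_norm (weak_orlicz M \<Phi>1) (weak_orlicz_norm M \<Phi>1)
                               (weak_orlicz_norm M \<Phi>2) g"
  proof -
    \<comment> \<open>Moving \<open>C\<close> to the left leaves a bare infimum on the right, to be
      bounded one admissible \<open>K\<close> at a time; \<open>C\<close> is positive and finite, so
      it can be moved back.\<close>
    have "ennreal (inverse C) * ?N \<le> PWM_norm (weak_orlicz M \<Phi>1) (weak_orlicz_norm M \<Phi>1)
                               (weak_orlicz_norm M \<Phi>2) g" (is "_ \<le> ?P")
      unfolding PWM_norm_def
    proof (rule Inf_greatest, clarify)
      fix K :: real
      assume "0 \<le> K" "\<forall>f\<in>weak_orlicz M \<Phi>1.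
        weak_orlicz_norm M \<Phi>2 (\<lambda>x. f x * g x) \<le> ennreal K * weak_orlicz_norm M \<Phi>1 f"
      then have "?N \<le> ennreal C * ennreal K" by (rule *)
      then have "ennreal (inverse C) * ?N \<le> ennreal (inverse C) * (ennreal C * ennreal K)"
        by (intro mult_left_mono) auto
      also have "\<dots> = ennreal K" using \<open>C > 0\<close> by (simp add: mult.assoc[symmetric] flip: ennreal_mult)
      finally show "ennreal (inverse C) * ?N \<le> ennreal K" .
    qed
    then have "ennreal C * (ennreal (inverse C) * ?N) \<le> ennreal C * ?P"
      by (intro mult_left_mono) auto
    moreover have "ennreal C * (ennreal (inverse C) * ?N) = ?N"
      using \<open>C > 0\<close> by (simp add: mult.assoc[symmetric] flip: ennreal_mult)
    ultimately show ?thesis by simp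
  qed
qed

end
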